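(* Let $q$ be an odd prime power, $m_1,n_1,m_2,n_2\in\{1,\dots,q-1\}$, and suppose $\phi\colon V(D(q;m_1,n_1))\to V(D(q;m_2,n_2))$, $\phi(x,y)=(f(x,y),g(x,y))$, is a digraph isomorphism, where $f,g\in\mathbb{F}_q[X,Y]$ have degree at most $q-1$ in each variable. Then: (i) $f$ and $g$ are permutation polynomials in two variables on $\mathbb{F}_q$; (ii) if $m_1\neq n_1$, then $f(x,y)=0$ if and only if $x=0$; (iii) if $m_1\neq n_1$, then $g$ is a polynomial in the indeterminate $Y$ only, of the form $g(Y)=a_{q-2}Y^{q-2}+a_{q-4}Y^{q-4}+\dots+a_1Y$ with all $a_i\in\mathbb{F}_q$ (only odd powers of $Y$ up to $q-2$ appear), and $g$ is a permutation polynomial on $\mathbb{F}_q$.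
   Context: $\mathbb{F}_q$ is the field with $q$ elements. For integers $1\le m,n\le q-1$, the monomial digraph $D(q;m,n)$ has vertex set $\mathbb{F}_q^2$, and $((x_1,x_2),(y_1,y_2))$ is an arc iff $x_2+y_2=x_1^m y_1^n$. A polynomial $h\in\mathbb{F}_q[X_1,\dots,X_n]$ is a permutation polynomial in $n$ variables on $\mathbb{F}_q$ if for each $\alpha\in\mathbb{F}_q$ the equation $h(x_1,\dots,x_n)=\alpha$ has exactly $q^{n-1}$ solutions in $\mathbb{F}_q^n$; for $n=1$ it is called a permutation polynomial on $\mathbb{F}_q$ (it induces a bijection of $\mathbb{F}_q$). *)

theory Defs
  imports
    "HOL-Library.Cardinality"
    "HOL-Computational_Algebra.Polynomial"
    "Graph_Theory.Pair_Digraph"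
    "Graph_Theory.Digraph_Isomorphism"
begin

definition monomial_digraph :: "nat \<Rightarrow> nat \<Rightarrow> ('a::{field,finite} \<times> 'a) pair_pre_digraph" where
  "monomial_digraph m n =
     \<lparr> pverts = UNIV,
       parcs = {((x1, x2), (y1, y2)) | x1 x2 y1 y2. x2 + y2 = x1 ^ m * y1 ^ n} \<rparr>"

text \<open>
  The library isomorphisms between digraphs are records that also carry an arc map; the map
  on vertices is an isomorphism if it is the vertex part of such a record.
\<close>

definition is_digraph_isomorphism ::
    "('a \<Rightarrow> 'b) \<Rightarrow> 'a pair_pre_digraph \<Rightarrow> 'b pair_pre_digraph \<Rightarrow> bool" where
  "is_digraph_isomorphism \<phi> G H \<longleftrightarrow>
     (\<exists>h. pre_digraph.digraph_isomorphism (with_proj G) h \<and>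
          with_proj H = app_iso h (with_proj G) \<and>
          (\<forall>v \<in> pverts G. iso_verts h v = \<phi> v))"

lemma is_digraph_isomorphism_iff:
  assumes "pair_wf_digraph G" "pair_wf_digraph H"
  shows "is_digraph_isomorphism \<phi> G H \<longleftrightarrow>
    bij_betw \<phi> (pverts G) (pverts H) \<and>
    (\<forall>u\<in>pverts G. \<forall>v\<in>pverts G. (u, v) \<in> parcs G \<longleftrightarrow> (\<phi> u, \<phi> v) \<in> parcs H)" (is "?L \<longleftrightarrow> ?R")
proof
  interpret G: pair_wf_digraph G by fact
  assume ?L
  then obtain h where iso: "pre_digraph.digraph_isomorphism (with_proj G) h"
    and H: "with_proj H = app_iso h (with_proj G)"
    and \<phi>: "\<forall>v \<in> pverts G. iso_verts h v = \<phi> v"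
    unfolding is_digraph_isomorphism_def by blast
  have inj: "inj_on (iso_verts h) (pverts G)"
    using iso by (simp add: pre_digraph.digraph_isomorphism_def)
  have vH: "pverts H = iso_verts h ` pverts G"
    using arg_cong[OF H, of verts] by simp
  have aH: "parcs H = iso_arcs h ` parcs G"
    using arg_cong[OF H, of arcs] by simp
  have tl: "iso_tail h = fst" and hd: "iso_head h = snd"
    using arg_cong[OF H, of tail] arg_cong[OF H, of head] by simp_all
  have ah: "iso_arcs h (u, v) = (iso_verts h u, iso_verts h v)" if "(u, v) \<in> parcs G" for u v
    using iso that unfolding pre_digraph.digraph_isomorphism_def
    by (auto simp: tl hd prod_eq_iff)
  have "bij_betw \<phi> (pverts G) (pverts H)"
    unfolding bij_betw_def vH using inj \<phi> by (auto simp: inj_on_def)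
  moreover have "(u, v) \<in> parcs G \<longleftrightarrow> (\<phi> u, \<phi> v) \<in> parcs H"
    if uv: "u \<in> pverts G" "v \<in> pverts G" for u v
  proof
    assume "(u, v) \<in> parcs G"
    then show "(\<phi> u, \<phi> v) \<in> parcs H"
      using ah[of u v] aH \<phi> uv by (metis image_eqI)
  next
    assume "(\<phi> u, \<phi> v) \<in> parcs H"
    then obtain a b where ab: "(a, b) \<in> parcs G" "iso_arcs h (a, b) = (\<phi> u, \<phi> v)"
      unfolding aH by force
    then have "iso_verts h a = iso_verts h u" "iso_verts h b = iso_verts h v"
      using ah \<phi> uv by auto
    then have "a = u" "b = v"
      using inj uv ab(1) G.in_arcsD1 G.in_arcsD2 by (auto dest: inj_onD)
    then show "(u, v) \<in> parcs G" using ab by simp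
  qed
  ultimately show ?R by blast
next
  interpret G: pair_wf_digraph G by fact
  interpret H: pair_wf_digraph H by fact
  assume R: ?R
  define h where "h = \<lparr>iso_verts = \<phi>, iso_arcs = map_prod \<phi> \<phi>, iso_head = snd, iso_tail = fst\<rparr>"
  have inj: "inj_on \<phi> (pverts G)" and img: "\<phi> ` pverts G = pverts H"
    using R by (auto simp: bij_betw_def)
  have "wf_digraph (with_proj G)" by (rule G.wf_digraph_axioms)
  moreover have "inj_on (map_prod \<phi> \<phi>) (parcs G)"
    using inj G.in_arcsD1 G.in_arcsD2 by (auto simp: inj_on_def)
  ultimately have 1: "pre_digraph.digraph_isomorphism (with_proj G) h"
    unfolding pre_digraph.digraph_isomorphism_def h_def using inj by simp
  have "parcs H = map_prod \<phi> \<phi> ` parcs G"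
  proof (intro equalityI subsetI)
    fix e assume e: "e \<in> parcs H"
    then obtain a b where "a \<in> pverts G" "b \<in> pverts G" "e = (\<phi> a, \<phi> b)"
      using H.arc_fst_in_verts H.arc_snd_in_verts img by (metis imageE prod.collapse)
    then show "e \<in> map_prod \<phi> \<phi> ` parcs G" using R e by (auto intro!: image_eqI[of _ _ "(a, b)"])
  next
    fix e assume "e \<in> map_prod \<phi> \<phi> ` parcs G"
    then obtain a b where ab: "(a, b) \<in> parcs G" "e = (\<phi> a, \<phi> b)" by auto
    then show "e \<in> parcs H" using R G.in_arcsD1[OF ab(1)] G.in_arcsD2[OF ab(1)] by simp
  qed
  then have "with_proj H = app_iso h (with_proj G)"
    using img by (simp add: app_iso_def with_proj_def h_def)
  with 1 show ?L unfolding is_digraph_isomorphism_def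
    by (intro exI[of _ h]) (simp add: h_def)
qed

text \<open>
  A polynomial in \<open>F[X,Y]\<close> is represented as an element of \<open>F[X][Y]\<close>, that is, as a polynomial
  in \<open>Y\<close> whose coefficients are polynomials in \<open>X\<close>.
\<close>

definition poly_XY :: "'a::comm_semiring_0 poly poly \<Rightarrow> 'a \<Rightarrow> 'a \<Rightarrow> 'a" where
  "poly_XY p x y = poly (poly p [:y:]) x"

definition degree_Y :: "'a::zero poly poly \<Rightarrow> nat" where
  "degree_Y p = degree p"

definition degree_X :: "'a::zero poly poly \<Rightarrow> nat" where
  "degree_X p = Max ((\<lambda>i. degree (coeff p i)) ` {..degree p})"

definition embed_Y :: "'a::zero poly \<Rightarrow> 'a poly poly" where
  "embed_Y h = map_poly (\<lambda>c. [:c:]) h"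

lemma poly_XY_altdef:
  fixes p :: "'a::comm_semiring_1 poly poly"
  shows "poly_XY p x y = (\<Sum>i\<le>degree p. poly (coeff p i) x * y ^ i)"
  by (simp add: poly_XY_def poly_altdef[of p] poly_sum poly_power)

lemma poly_XY_embed_Y:
  fixes h :: "'a::comm_semiring_1 poly"
  shows "poly_XY (embed_Y h) x y = poly h y"
  by (induction h) (simp_all add: poly_XY_def embed_Y_def map_poly_pCons)

lemma degree_X_le_iff:
  "degree_X p \<le> d \<longleftrightarrow> (\<forall>i. degree (coeff p i) \<le> d)"
proof
  assume a: "degree_X p \<le> d"
  show "\<forall>i. degree (coeff p i) \<le> d"
  proof
    fix i show "degree (coeff p i) \<le> d"
      using a by (cases "i \<le> degree p") (auto simp: degree_X_def coeff_eq_0)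
  qed
qed (auto simp: degree_X_def)

definition perm_poly_XY :: "'a::{field,finite} poly poly \<Rightarrow> bool" where
  "perm_poly_XY h \<longleftrightarrow> (\<forall>\<alpha>. card {(x, y). poly_XY h x y = \<alpha>} = CARD('a) ^ (2 - 1))"

definition perm_poly :: "'a::{field,finite} poly \<Rightarrow> bool" where
  "perm_poly h \<longleftrightarrow> (\<forall>\<alpha>. card {x. poly h x = \<alpha>} = CARD('a) ^ (1 - 1))"

lemma perm_poly_iff_bij: "perm_poly h \<longleftrightarrow> bij (poly h)"
proof -
  have "card {x. poly h x = \<alpha>} = 1 \<longleftrightarrow> (\<exists>!x. poly h x = \<alpha>)" for \<alpha>
    by (simp add: card_1_singleton_iff set_eq_iff Ex1_def) blast
  then show ?thesis
    by (simp add: perm_poly_def bij_iff)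
qed

end

theory Submission
  imports Defs
begin

text \<open>
  A vertex of \<open>D(q;m,n)\<close> with first coordinate \<open>0\<close> has the same out- and in-neighbours. For
  \<open>m \<noteq> n\<close> no other vertex has this property, because \<open>X\<^sup>m\<close> and \<open>X\<^sup>n\<close> then induce distinct
  functions on \<open>\<F>\<^sub>q\<close>. An isomorphism preserves the property, so it maps the line \<open>x = 0\<close> onto
  itself. The arcs \<open>(0,c) \<rightarrow> (x,-c)\<close> then give \<open>g(x,-c) = -g(0,c)\<close>, so \<open>g\<close> depends on \<open>y\<close>
  only and is odd; the degree bounds turn these identities of functions into identities of
  polynomials.
\<close>

text \<open>A nonzero difference of degree below \<open>CARD('a)\<close> cannot vanish at all
  \<open>CARD('a)\<close> points.\<close>

lemma poly_eqI_finite_field: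
  fixes p r :: "'a::{field,finite} poly"
  assumes "\<And>x. poly p x = poly r x" "degree p < CARD('a)" "degree r < CARD('a)"
  shows "p = r"
  using poly_eqI_degree[of UNIV p r] assms by simp

lemma power_fun_inj_finite_field:
  fixes m n :: nat
  assumes "\<And>y::'a::{field,finite}. y ^ m = y ^ n" "m < CARD('a)" "n < CARD('a)"
  shows "m = n"
proof -
  have "monom (1::'a) m = monom 1 n"
    using assms by (intro poly_eqI_finite_field) (simp_all add: poly_monom degree_monom_eq)
  then show ?thesis
    by (metis degree_monom_eq zero_neq_one)
qed

text \<open>Translation by 1 permutes the ring, so summing \<open>x + 1\<close> or \<open>x\<close>
  over all elements gives the same value; the two sums differ by
  \<open>of_nat CARD('a)\<close>.\<close>

lemma of_nat_CARD_eq_0: "of_nat CARD('a) = (0::'a::{comm_ring_1,finite})"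
proof -
  have "(\<Sum>x\<in>UNIV. x + 1) = (\<Sum>x\<in>UNIV. x::'a)"
    by (rule sum.reindex_bij_betw[of "\<lambda>x. x + 1"]) 
      (auto intro!: bij_betwI[where g = "\<lambda>x. x - 1"])
  then show ?thesis
    by (simp add: sum.distrib)
qed

lemma two_neq_zero_odd_card:
  assumes "odd CARD('a::{field,finite})"
  shows "(2::'a) \<noteq> 0"
proof
  assume 2: "(2::'a) = 0"
  obtain k where "CARD('a) = 2 * k + 1"
    using assms by (elim oddE)
  then have "of_nat CARD('a) = (1::'a)"
    using 2 by simp
  then show False
    by (simp add: of_nat_CARD_eq_0)
qed

lemma in_parcs_monomial_digraph [simp]:
  "((x1, x2), (y1, y2)) \<in> parcs (monomial_digraph m n) \<longleftrightarrow> x2 + y2 = x1 ^ m * y1 ^ n"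
  by (simp add: monomial_digraph_def)

lemma pverts_monomial_digraph [simp]: "pverts (monomial_digraph m n) = UNIV"
  by (simp add: monomial_digraph_def)

lemma pair_wf_monomial_digraph: "pair_wf_digraph (monomial_digraph m n)"
  by unfold_locales simp_all

lemma is_digraph_isomorphism_monomial_digraph_iff:
  "is_digraph_isomorphism \<phi> (monomial_digraph m1 n1) (monomial_digraph m2 n2) \<longleftrightarrow>
     bij \<phi> \<and> (\<forall>u v. (u, v) \<in> parcs (monomial_digraph m1 n1) \<longleftrightarrow>
                      (\<phi> u, \<phi> v) \<in> parcs (monomial_digraph m2 n2))"
  by (simp add: is_digraph_isomorphism_iff pair_wf_monomial_digraph del: split_paired_All)

definition same_nbrs :: "'a pair_pre_digraph \<Rightarrow> 'a \<Rightarrow> bool" where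
  "same_nbrs G u \<longleftrightarrow> (\<forall>v. (u, v) \<in> parcs G \<longleftrightarrow> (v, u) \<in> parcs G)"

lemma same_nbrs_iso:
  assumes "surj \<phi>" "\<And>u v. (u, v) \<in> parcs G \<longleftrightarrow> (\<phi> u, \<phi> v) \<in> parcs H"
  shows "same_nbrs H (\<phi> u) \<longleftrightarrow> same_nbrs G u"
  unfolding same_nbrs_def using assms by (metis surjD)

lemma same_nbrs_monomial_digraph_zero:
  assumes "m \<ge> 1" "n \<ge> 1"
  shows "same_nbrs (monomial_digraph m n) (0, c)"
  using assms by (auto simp: same_nbrs_def add.commute power_0_left)

text \<open>Serves to rule out \<open>m2 = n2\<close>: the property would then hold at every vertex
  and single out no line.\<close>

lemma same_nbrs_monomial_digraph_diag: "same_nbrs (monomial_digraph m m) u"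
  by (cases u) (auto simp: same_nbrs_def add.commute mult.commute)

lemma same_nbrs_monomial_digraph_iff:
  fixes c d :: "'a::{field,finite}"
  assumes "m \<in> {1..CARD('a) - 1}" "n \<in> {1..CARD('a) - 1}" "m \<noteq> n"
  shows "same_nbrs (monomial_digraph m n) (d, c) \<longleftrightarrow> d = 0"
proof
  assume same: "same_nbrs (monomial_digraph m n) (d, c)"
  show "d = 0"
  proof (rule ccontr)
    assume d: "d \<noteq> 0"
    \<comment> \<open>The witness is the unique out-neighbour of \<open>(d, c)\<close> with first
      coordinate \<open>y\<close>; it must be an in-neighbour too.\<close>
    have eq: "d ^ m * y ^ n = y ^ m * d ^ n" for y
      using same[unfolded same_nbrs_def, rule_format, of "(y, d ^ m * y ^ n - c)"] by simp
    have "d ^ m = d ^ n"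
      using eq[of 1] by simp
    then have "y ^ m = y ^ n" for y :: 'a
      using eq[of y] d by (metis mult.commute mult_left_cancel power_not_zero)
    then have "m = n"
      using assms by (intro power_fun_inj_finite_field[where 'a = 'a]) auto
    with assms show False by simp
  qed
qed (use assms in \<open>simp add: same_nbrs_monomial_digraph_zero\<close>)

lemma poly_XY_eq_poly_map_poly:
  "poly_XY p x y = poly (map_poly (\<lambda>c. poly c x) p) y" for p :: "'a::comm_semiring_1 poly poly"
  by (induction p) (simp_all add: poly_XY_def map_poly_pCons)

text \<open>Functions become polynomials one variable at a time: first in Y for each fixed
  \<open>x\<close>, then in X for each coefficient, which is thereby constant.\<close>

lemma embed_Y_if_poly_XY_indep:
  fixes p :: "'a::{field,finite} poly poly"
  assumes indep: "\<And>x y. poly_XY p x y = poly_XY p 0 y"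
    and deg: "degree_X p < CARD('a)" "degree_Y p < CARD('a)"
  shows "p = embed_Y (map_poly (\<lambda>c. poly c 0) p)"
proof (rule poly_eqI)
  fix i
  have dm: "degree (map_poly (\<lambda>c. poly c x) p) < CARD('a)" for x
    using map_poly_degree_leq[of "\<lambda>c. poly c x" p] deg(2) by (simp add: degree_Y_def)
  have eq: "map_poly (\<lambda>c. poly c x) p = map_poly (\<lambda>c. poly c 0) p" for x
    using indep dm by (intro poly_eqI_finite_field) (simp_all add: poly_XY_eq_poly_map_poly)
  have "poly (coeff p i) x = poly (coeff p i) 0" for x
    using arg_cong[OF eq[of x], of "\<lambda>r. coeff r i"] by (simp add: coeff_map_poly)
  moreover have "degree (coeff p i) < CARD('a)"
    using deg(1) degree_X_le_iff[of p "degree_X p"] by (meson le_less_trans order_refl)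
  ultimately have "coeff p i = [:poly (coeff p i) 0:]"
    by (intro poly_eqI_finite_field) simp_all
  then show "coeff p i = coeff (embed_Y (map_poly (\<lambda>c. poly c 0) p)) i"
    by (simp add: embed_Y_def coeff_map_poly)
qed

text \<open>The degree bound lifts oddness to the identity p(-X) = -p(X), so an even coefficient is
  its own negative, and 2 is invertible.\<close>

lemma coeff_even_eq_0_if_odd_poly:
  fixes p :: "'a::{field,finite} poly"
  assumes "odd CARD('a)" "\<And>y. poly p (- y) = - poly p y" "degree p < CARD('a)" "even i"
  shows "coeff p i = 0"
proof -
  have "pcompose p [:0, -1:] = - p"
    using assms by (intro poly_eqI_finite_field) (simp_all add: poly_pcompose degree_pcompose)
  then have "coeff p i = - coeff p i"
    using coeff_pcompose_linear[of p "-1" i] assms(4) by simp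
  then have "2 * coeff p i = 0"
    unfolding eq_neg_iff_add_eq_0 mult_2 .
  then show ?thesis
    using two_neq_zero_odd_card[OF assms(1)] by simp
qed

lemma poly_eq_sum_odd_monom:
  fixes p :: "'a::comm_monoid_add poly"
  assumes "\<And>i. even i \<Longrightarrow> coeff p i = 0" "degree p < q" "odd q"
  shows "p = (\<Sum>i | odd i \<and> i \<le> q - 2. monom (coeff p i) i)"
proof (rule poly_eqI)
  fix j
  have fin: "finite {i. odd i \<and> i \<le> q - 2}"
    by simp
  have "coeff p j = 0" if "\<not> (odd j \<and> j \<le> q - 2)"
  proof (cases "odd j")
    case True
    \<comment> \<open>The exponent \<open>q - 1\<close> is even, so an odd \<open>j\<close> above
      \<open>q - 2\<close> is at least \<open>q\<close>.\<close>
    with that \<open>odd q\<close> have "q \<le> j"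
      by presburger
    then show ?thesis
      using assms(2) by (simp add: coeff_eq_0)
  qed (use assms(1) in simp)
  then show "coeff p j = coeff (\<Sum>i | odd i \<and> i \<le> q - 2. monom (coeff p i) i) j"
    using fin by (auto simp: coeff_sum sum.delta')
qed

lemma card_fibre_fst: "card {u :: 'a \<times> 'b. fst u = \<alpha>} = CARD('b)"
proof -
  have "{u :: 'a \<times> 'b. fst u = \<alpha>} = {\<alpha>} \<times> UNIV"
    by auto
  then show ?thesis
    by (simp add: card_cartesian_product_singleton)
qed

lemma card_fibre_snd: "card {u :: 'a \<times> 'b. snd u = \<alpha>} = CARD('a)"
proof -
  have "{u :: 'a \<times> 'b. snd u = \<alpha>} = UNIV \<times> {\<alpha>}"
    by auto
  then show ?thesis
    by (simp add: card_cartesian_product)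
qed

text \<open>The fibres of \<open>f\<close> and \<open>g\<close> are the preimages under
  \<open>\<phi>\<close> of coordinate lines, and a bijection preserves cardinality.\<close>

lemma perm_poly_XY_components_if_bij:
  fixes f g :: "'a::{field,finite} poly poly"
  assumes "bij \<phi>" "\<And>x y. \<phi> (x, y) = (poly_XY f x y, poly_XY g x y)"
  shows "perm_poly_XY f" "perm_poly_XY g"
proof -
  have vimage: "card {u. P (\<phi> u)} = card {u. P u}" for P
    using card_vimage_inj[of \<phi> "{u. P u}"] assms(1) by (simp add: bij_def vimage_def)
  have "{(x, y). poly_XY f x y = \<alpha>} = {u. fst (\<phi> u) = \<alpha>}"
    "{(x, y). poly_XY g x y = \<alpha>} = {u. snd (\<phi> u) = \<alpha>}" for \<alpha>
    by (auto simp: assms(2))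
  then show "perm_poly_XY f" "perm_poly_XY g"
    by (simp_all add: perm_poly_XY_def card_fibre_fst card_fibre_snd 
        vimage[of "\<lambda>u. fst u = _"] vimage[of "\<lambda>u. snd u = _"])
qed

theorem theorem4:
  fixes f g :: "'a::{field,finite} poly poly"
    and \<phi> :: "'a \<times> 'a \<Rightarrow> 'a \<times> 'a"
    and q m1 n1 m2 n2 :: nat
  assumes "q = CARD('a)" and "odd q"
    and "m1 \<in> {1..q - 1}" and "n1 \<in> {1..q - 1}"
    and "m2 \<in> {1..q - 1}" and "n2 \<in> {1..q - 1}"
    and "is_digraph_isomorphism \<phi> (monomial_digraph m1 n1) (monomial_digraph m2 n2)"
    and "\<And>x y. \<phi> (x, y) = (poly_XY f x y, poly_XY g x y)"
    and "degree_X f \<le> q - 1" and "degree_Y f \<le> q - 1"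
    and "degree_X g \<le> q - 1" and "degree_Y g \<le> q - 1"
  shows "(perm_poly_XY f \<and> perm_poly_XY g) \<and>
    (m1 \<noteq> n1 \<longrightarrow> (\<forall>x y. poly_XY f x y = 0 \<longleftrightarrow> x = 0)) \<and>
    (m1 \<noteq> n1 \<longrightarrow>
      (\<exists>(G :: 'a poly) (a :: nat \<Rightarrow> 'a).
        g = embed_Y G \<and> G = (\<Sum>i | odd i \<and> i \<le> q - 2. monom (a i) i) \<and> perm_poly G))"
proof -
  note q = assms(1)
  have bij: "bij \<phi>"
    and arcs: "\<And>u v. (u, v) \<in> parcs (monomial_digraph m1 n1) \<longleftrightarrow>
                      (\<phi> u, \<phi> v) \<in> parcs (monomial_digraph m2 n2)"
    using assms(7) unfolding is_digraph_isomorphism_monomial_digraph_iff by blast+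
  have pos: "CARD('a) > 0"
    by simp
  have f0: "poly_XY f x y = 0 \<longleftrightarrow> x = 0" if ne: "m1 \<noteq> n1" for x y
  proof -
    have same: "same_nbrs (monomial_digraph m2 n2) (\<phi> (x, y)) \<longleftrightarrow> x = 0" for x y
      using same_nbrs_iso[OF bij_is_surj[OF bij] arcs, of "(x, y)"]
        same_nbrs_monomial_digraph_iff[of m1 n1 x y] assms(3,4) ne q by simp
    \<comment> \<open>The vertex \<open>(1, 0)\<close> lies off the line \<open>x = 0\<close>, so
      its image lacks the property.\<close>
    have "m2 \<noteq> n2"
      using same[of 1 0] same_nbrs_monomial_digraph_diag[of n2 "\<phi> (1, 0)"] by auto
    then show ?thesis
      using same[of x y]
        same_nbrs_monomial_digraph_iff[of m2 n2 "poly_XY f x y" "poly_XY g x y"]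
        assms(5,6) q by (simp add: assms(8))
  qed
  have "\<exists>(G :: 'a poly) (a :: nat \<Rightarrow> 'a).
      g = embed_Y G \<and> G = (\<Sum>i | odd i \<and> i \<le> q - 2. monom (a i) i) \<and> perm_poly G"
    if ne: "m1 \<noteq> n1"
  proof -
    \<comment> \<open>Since \<open>n1\<close> may differ from \<open>m1\<close> but
      \<open>m1\<close> and \<open>m2\<close> are positive, the tails \<open>(0, c)\<close> and
      \<open>\<phi> (0, c)\<close>, both with first coordinate 0, make the right-hand sides of both
      arc equations vanish.\<close>
    have neg: "poly_XY g x (- c) = - poly_XY g 0 c" for x c
      using arcs[of "(0, c)" "(x, - c)"] f0[OF ne, of 0 c] assms(3,5)
      by (simp add: assms(8) power_0_left eq_neg_iff_add_eq_0 add.commute)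
    have indep: "poly_XY g x y = poly_XY g 0 y" for x y
      using neg[of x "- y"] neg[of 0 "- y"] by simp
    define G where "G = map_poly (\<lambda>c. poly c 0) g"
    have degY: "degree_Y g < CARD('a)" and degX: "degree_X g < CARD('a)"
      using assms(11,12) q pos by linarith+
    have g: "g = embed_Y G"
      unfolding G_def using indep degX degY by (rule embed_Y_if_poly_XY_indep)
    have eval: "poly_XY g x y = poly G y" for x y
      by (simp add: g poly_XY_embed_Y)
    have degG: "degree G < CARD('a)"
      using map_poly_degree_leq[of "\<lambda>c. poly c 0" g] degY by (simp add: G_def degree_Y_def)
    have "coeff G i = 0" if "even i" for i
      using coeff_even_eq_0_if_odd_poly[of G i] neg[unfolded eval] degG assms(2) q that by simp
    then have "G = (\<Sum>i | odd i \<and> i \<le> q - 2. monom (coeff G i) i)"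
      using degG assms(2) q by (intro poly_eq_sum_odd_monom) simp_all
    \<comment> \<open>On the line \<open>x = 0\<close> the map is
      \<open>\<phi> (0, y) = (0, poly G y)\<close>, so \<open>G\<close> inherits injectivity from
      \<open>\<phi>\<close>.\<close>
    moreover have "inj (poly G)"
    proof (rule injI)
      fix y z assume "poly G y = poly G z"
      then have "\<phi> (0, y) = \<phi> (0, z)"
        using f0[OF ne, of 0] by (simp add: assms(8) eval)
      then show "y = z"
        using bij by (auto simp: bij_def dest: injD)
    qed
    then have "perm_poly G"
      by (simp add: perm_poly_iff_bij bij_def finite_UNIV_inj_surj)
    ultimately show ?thesis
      using g by blast
  qed
  then show ?thesis
    using perm_poly_XY_components_if_bij[OF bij assms(8)] f0 by blast
qed

end
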